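(* Let $\varphi=[\varphi_{ij}]_{i,j\in\mathbb N}$ be a complex matrix such that the Schur multiplier $M_\varphi\colon B(\ell_2)\to B(\ell_2)$, $M_\varphi([x_{ij}])=[\varphi_{ij}x_{ij}]$, is defined on $B(\ell_2)$. Then $M_\varphi$ is completely co-bounded on $B(\ell_2)$ if and only if the matrix $[|\varphi_{ij}|]$ defines a bounded operator on $\ell_2$, and in that case $$\|M_\varphi\|_{cob}=\|TM_\varphi\|_{cb}=\big\|[|\varphi_{ij}|]\big\|_{B(\ell_2)},$$ where $T\colon B(\ell_2)\to B(\ell_2)$ denotes the transposition $[x_{ij}]\mapsto[x_{ji}]$. Moreover, if $\|M_\varphi\|_{cob}\le 1$, then $M_\varphi$ admits a factorization $$B(\ell_2)\xrightarrow{\ J\ }\ell_\infty(\mathbb N\times\mathbb N)\xrightarrow{\ \mathcal M_\varphi\ }B(\ell_2),\qquad M_\varphi=\mathcal M_\varphi J,$$ where $J$ is the natural inclusion map $[x_{ij}]\mapsto (x_{ij})_{i,j}$, where $\mathcal M_\varphi\colon \ell_\infty(\mathbb N\times\mathbb N)\to B(\ell_2)$ is the map $(x_{ij})\mapsto[\varphi_{ij}x_{ij}]$, and where $\|\mathcal M_\varphi\|_{cb}\le 1$.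
   Context: Operators on $\ell_2=\ell_2(\mathbb N)$ are identified with their matrices in the canonical basis. An operator space is a Banach space $E$ with an isometric embedding $E\subset B(H)$ for some Hilbert space $H$; $M_n(E)$ carries the norm induced by $M_n(B(H))=B(H\oplus\cdots\oplus H)$. A linear map $u\colon E\to F$ between operator spaces is completely bounded (c.b.) if $\|u\|_{cb}=\sup_{n\ge1}\|u_n\colon M_n(E)\to M_n(F)\|<\infty$, where $u_n([a_{ij}])=[u(a_{ij})]$. The opposite operator space $E^{op}$ is the same Banach space as $E$ with matrix norms $\|[a_{ij}]\|_{M_n(E^{op})}=\|[a_{ji}]\|_{M_n(E)}$. A linear map $u\colon E\to F$ is completely co-bounded if it is completely bounded as a map $E\to F^{op}$, and $\|u\|_{cob}=\|u\colon E\to F^{op}\|_{cb}$. The space $\ell_\infty(\mathbb N\times\mathbb N)$ has its operator space structure as a commutative $C^*$-algebra. *)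

theory Defs
  imports "HOL-Analysis.Analysis"
begin

text \<open>Square-summable families over an index set, and operators between them given by their
  matrices in the canonical basis. Only the values on the index set \<^term>\<open>I\<close> matter.\<close>

definition ell2 :: "'i set \<Rightarrow> ('i \<Rightarrow> complex) set" where
  "ell2 I = {x. (\<lambda>i. (cmod (x i))\<^sup>2) summable_on I}"

definition ell2_norm :: "'i set \<Rightarrow> ('i \<Rightarrow> complex) \<Rightarrow> real" where
  "ell2_norm I x = sqrt (\<Sum>\<^sub>\<infinity>i\<in>I. (cmod (x i))\<^sup>2)"

definition mat_app :: "'i set \<Rightarrow> ('i \<Rightarrow> 'i \<Rightarrow> complex) \<Rightarrow> ('i \<Rightarrow> complex) \<Rightarrow> 'i \<Rightarrow> complex" where
  "mat_app I a x = (\<lambda>i. \<Sum>\<^sub>\<infinity>j\<in>I. a i j * x j)"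

definition bounded_matrix :: "'i set \<Rightarrow> ('i \<Rightarrow> 'i \<Rightarrow> complex) \<Rightarrow> bool" where
  "bounded_matrix I a \<longleftrightarrow>
     (\<forall>x\<in>ell2 I. (\<forall>i\<in>I. (\<lambda>j. a i j * x j) summable_on I) \<and> mat_app I a x \<in> ell2 I) \<and>
     (\<exists>C. \<forall>x\<in>ell2 I. ell2_norm I (mat_app I a x) \<le> C * ell2_norm I x)"

text \<open>The operator norm; meaningful only for matrices satisfying \<^const>\<open>bounded_matrix\<close>.\<close>

definition op_norm :: "'i set \<Rightarrow> ('i \<Rightarrow> 'i \<Rightarrow> complex) \<Rightarrow> real" where
  "op_norm I a = Sup {ell2_norm I (mat_app I a x) | x. x \<in> ell2 I \<and> ell2_norm I x \<le> 1}"

text \<open>The data of an operator space that enter into complete boundedness: the complex vector space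
  and the norms of the spaces of \<open>n \<times> n\<close> matrices over it. An element of the latter is a function
  \<^typ>\<open>nat \<Rightarrow> nat \<Rightarrow> 'e\<close> of which only the entries with indices below \<open>n\<close> matter.\<close>

record 'e op_space =
  carr :: "'e set"
  add :: "'e \<Rightarrow> 'e \<Rightarrow> 'e"
  scl :: "complex \<Rightarrow> 'e \<Rightarrow> 'e"
  mnorm :: "nat \<Rightarrow> (nat \<Rightarrow> nat \<Rightarrow> 'e) \<Rightarrow> real"

text \<open>For \<open>E\<close> embedded by \<open>\<iota>\<close> into the bounded operators on \<open>H\<close>, the square-summable families over
  \<^typ>\<open>'i\<close>, an \<open>n \<times> n\<close> matrix over \<open>E\<close> acts on the \<open>n\<close>-fold direct sum of \<open>H\<close>, which is the space
  of square-summable families over \<open>{..<n} \<times> UNIV\<close>.\<close>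

definition block_matrix ::
  "('e \<Rightarrow> 'i \<Rightarrow> 'i \<Rightarrow> complex) \<Rightarrow> (nat \<Rightarrow> nat \<Rightarrow> 'e) \<Rightarrow> nat \<times> 'i \<Rightarrow> nat \<times> 'i \<Rightarrow> complex" where
  "block_matrix \<iota> a = (\<lambda>(p, i) (q, j). \<iota> (a p q) i j)"

definition embedded_mnorm ::
  "('e \<Rightarrow> 'i \<Rightarrow> 'i \<Rightarrow> complex) \<Rightarrow> nat \<Rightarrow> (nat \<Rightarrow> nat \<Rightarrow> 'e) \<Rightarrow> real" where
  "embedded_mnorm \<iota> n a = op_norm ({..<n} \<times> UNIV) (block_matrix \<iota> a)"

definition B_ell2 :: "(nat \<Rightarrow> nat \<Rightarrow> complex) op_space" where
  "B_ell2 = \<lparr> carr = {x. bounded_matrix UNIV x},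
              add = (\<lambda>x y i j. x i j + y i j),
              scl = (\<lambda>c x i j. c * x i j),
              mnorm = embedded_mnorm (\<lambda>x. x) \<rparr>"

text \<open>The commutative C*-algebra of bounded functions on \<^typ>\<open>nat \<times> nat\<close>, represented faithfully by
  diagonal operators on the square-summable families over \<^typ>\<open>nat \<times> nat\<close>.\<close>

definition diag :: "('k \<Rightarrow> complex) \<Rightarrow> 'k \<Rightarrow> 'k \<Rightarrow> complex" where
  "diag f = (\<lambda>k l. if k = l then f k else 0)"

definition linf :: "(nat \<times> nat \<Rightarrow> complex) op_space" where
  "linf = \<lparr> carr = {f. bounded (range f)},
            add = (\<lambda>f g k. f k + g k),
            scl = (\<lambda>c f k. c * f k),
            mnorm = embedded_mnorm diag \<rparr>"

definition opposite :: "'e op_space \<Rightarrow> 'e op_space" where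
  "opposite E = E\<lparr> mnorm := (\<lambda>n a. mnorm E n (\<lambda>i j. a j i)) \<rparr>"

definition linear_map :: "'e op_space \<Rightarrow> 'f op_space \<Rightarrow> ('e \<Rightarrow> 'f) \<Rightarrow> bool" where
  "linear_map E F u \<longleftrightarrow>
     (\<forall>x\<in>carr E. u x \<in> carr F) \<and>
     (\<forall>x\<in>carr E. \<forall>y\<in>carr E. u (add E x y) = add F (u x) (u y)) \<and>
     (\<forall>c. \<forall>x\<in>carr E. u (scl E c x) = scl F c (u x))"

definition amp_norm :: "'e op_space \<Rightarrow> 'f op_space \<Rightarrow> ('e \<Rightarrow> 'f) \<Rightarrow> nat \<Rightarrow> ennreal" where
  "amp_norm E F u n =
     (SUP a \<in> {a. (\<forall>i<n. \<forall>j<n. a i j \<in> carr E) \<and> mnorm E n a \<le> 1}.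
        ennreal (mnorm F n (\<lambda>i j. u (a i j))))"

definition cb_norm :: "'e op_space \<Rightarrow> 'f op_space \<Rightarrow> ('e \<Rightarrow> 'f) \<Rightarrow> ennreal" where
  "cb_norm E F u = (SUP n\<in>{1..}. amp_norm E F u n)"

definition completely_bounded :: "'e op_space \<Rightarrow> 'f op_space \<Rightarrow> ('e \<Rightarrow> 'f) \<Rightarrow> bool" where
  "completely_bounded E F u \<longleftrightarrow> linear_map E F u \<and> cb_norm E F u < \<infinity>"

definition cob_norm :: "'e op_space \<Rightarrow> 'f op_space \<Rightarrow> ('e \<Rightarrow> 'f) \<Rightarrow> ennreal" where
  "cob_norm E F u = cb_norm E (opposite F) u"

definition completely_cobounded :: "'e op_space \<Rightarrow> 'f op_space \<Rightarrow> ('e \<Rightarrow> 'f) \<Rightarrow> bool" where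
  "completely_cobounded E F u \<longleftrightarrow> completely_bounded E (opposite F) u"

definition schur ::
  "(nat \<Rightarrow> nat \<Rightarrow> complex) \<Rightarrow> (nat \<Rightarrow> nat \<Rightarrow> complex) \<Rightarrow> nat \<Rightarrow> nat \<Rightarrow> complex" where
  "schur \<phi> x = (\<lambda>i j. \<phi> i j * x i j)"

definition mat_transp :: "(nat \<Rightarrow> nat \<Rightarrow> complex) \<Rightarrow> nat \<Rightarrow> nat \<Rightarrow> complex" where
  "mat_transp x = (\<lambda>i j. x j i)"

definition abs_matrix :: "(nat \<Rightarrow> nat \<Rightarrow> complex) \<Rightarrow> nat \<Rightarrow> nat \<Rightarrow> complex" where
  "abs_matrix \<phi> = (\<lambda>i j. complex_of_real (cmod (\<phi> i j)))"

definition incl :: "(nat \<Rightarrow> nat \<Rightarrow> complex) \<Rightarrow> nat \<times> nat \<Rightarrow> complex" where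
  "incl x = (\<lambda>(i, j). x i j)"

definition linf_schur ::
  "(nat \<Rightarrow> nat \<Rightarrow> complex) \<Rightarrow> (nat \<times> nat \<Rightarrow> complex) \<Rightarrow> nat \<Rightarrow> nat \<Rightarrow> complex" where
  "linf_schur \<phi> f = (\<lambda>i j. \<phi> i j * f (i, j))"

end

theory Submission
  imports Defs
begin

text \<open>
  Write \<open>A\<close> for the matrix \<open>[|\<phi>\<^sub>i\<^sub>j|]\<close>. Both estimates come from reading an \<open>n \<times> n\<close> matrix
  \<open>[a\<^sub>p\<^sub>q]\<close> over \<open>B(\<ell>\<^sub>2)\<close> as one matrix with rows \<open>(p, i)\<close> and columns \<open>(q, j)\<close>. The map into the opposite
  space sends it to the matrix with entries \<open>\<phi>\<^sub>i\<^sub>j (a\<^sub>q\<^sub>p)\<^sub>i\<^sub>j\<close>: the outer indices are transposed, the inner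
  ones are not.

  \<^emph>\<open>The norm of \<open>A\<close> is an upper bound\<close> (\<open>form_bound_schur_entrywise\<close>). Fix the inner indices \<open>i, j\<close>.
  The scalar matrix \<open>[(a\<^sub>p\<^sub>q)\<^sub>i\<^sub>j]\<^sub>p\<^sub>q\<close> is a compression of \<open>a\<close>, hence a contraction if \<open>a\<close> is one, and a
  scalar matrix has the same norm as its transpose. Pairing the image of \<open>a\<close> with vectors
  \<open>y = (y\<^sub>i)\<close> and \<open>x = (x\<^sub>j)\<close>, cut into pieces of length \<open>n\<close>, gives at most
  \<open>\<Sum>\<^sub>i\<^sub>j |\<phi>\<^sub>i\<^sub>j| \<parallel>y\<^sub>i\<parallel> \<parallel>x\<^sub>j\<parallel>\<close>, and this is the form of \<open>A\<close> at the vectors of the norms of the pieces. The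
  argument applies to any scalar contractions attached to the positions \<open>(i, j)\<close>. Matrices of bounded
  functions on \<open>\<nat> \<times> \<nat>\<close> are of this kind, and this gives the factorization.

  \<^emph>\<open>The norm of \<open>A\<close> is a lower bound\<close> (\<open>form_bound_abs_matrix_if_mnorm_opposite_schur_le\<close>). Test
  on \<open>a\<^sub>p\<^sub>q = c\<^sub>p\<^sub>q e\<^sub>q\<^sub>p\<close> with \<open>|c\<^sub>p\<^sub>q| \<le> 1\<close>. As one matrix this is the flip of \<open>\<ell>\<^sub>2\<^sup>n \<otimes> \<ell>\<^sub>2\<^sup>n\<close> with weights,
  so it is a contraction. Transposing the outer indices turns it into a matrix that, on the diagonal
  vectors \<open>e\<^sub>p \<otimes> e\<^sub>p\<close>, is the full matrix \<open>[c\<^sub>q\<^sub>p]\<close>; the multiplier turns that into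
  \<open>[\<phi>\<^sub>p\<^sub>q c\<^sub>q\<^sub>p]\<close>, which is the corner \<open>[|\<phi>\<^sub>p\<^sub>q|]\<close> of \<open>A\<close> for the right phases \<open>c\<close>. So all finite corners of
  \<open>A\<close> are bounded by the norm of the multiplier.

  Boundedness and norms are handled throughout by the bilinear form of a matrix on finitely supported
  vectors (\<open>form_bound\<close>): transposition, compression and estimates of entries are then statements
  about finite sums, and infinite sums occur only in the proof that the two notions agree
  (\<open>form_bound_imp_bounded_matrix\<close>, \<open>bounded_matrix_imp_form_bound\<close>).
\<close>

section \<open>Bounded matrices and their bilinear forms\<close>

text \<open>The form is bilinear, not sesquilinear: since the vectors are arbitrary this gives the same bound,
  and transposition then amounts to exchanging the two vectors. The supports \<open>F\<close> and \<open>G\<close> are allowed to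
  differ because rows and columns are reindexed separately below.\<close>

definition form_bound :: "'i set \<Rightarrow> real \<Rightarrow> ('i \<Rightarrow> 'i \<Rightarrow> complex) \<Rightarrow> bool" where
  "form_bound I C b \<longleftrightarrow>
     (\<forall>F G x y. finite F \<longrightarrow> finite G \<longrightarrow> F \<subseteq> I \<longrightarrow> G \<subseteq> I \<longrightarrow>
        cmod (\<Sum>i\<in>F. \<Sum>j\<in>G. y i * b i j * x j)
          \<le> C * L2_set (\<lambda>i. cmod (y i)) F * L2_set (\<lambda>j. cmod (x j)) G)"

lemma form_boundI:
  assumes "\<And>F G x y. finite F \<Longrightarrow> finite G \<Longrightarrow> F \<subseteq> I \<Longrightarrow> G \<subseteq> I \<Longrightarrow>
        cmod (\<Sum>i\<in>F. \<Sum>j\<in>G. y i * b i j * x j)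
          \<le> C * L2_set (\<lambda>i. cmod (y i)) F * L2_set (\<lambda>j. cmod (x j)) G"
  shows "form_bound I C b"
  using assms unfolding form_bound_def by blast

lemma form_boundD:
  assumes "form_bound I C b" "finite F" "finite G" "F \<subseteq> I" "G \<subseteq> I"
  shows "cmod (\<Sum>i\<in>F. \<Sum>j\<in>G. y i * b i j * x j)
          \<le> C * L2_set (\<lambda>i. cmod (y i)) F * L2_set (\<lambda>j. cmod (x j)) G"
  using assms unfolding form_bound_def by blast

lemma form_bound_mono:
  assumes "form_bound I C b" "C \<le> D"
  shows "form_bound I D b"
proof (rule form_boundI)
  fix F G and x y :: "_ \<Rightarrow> complex" assume "finite F" "finite G" "F \<subseteq> I" "G \<subseteq> I"
  then have "cmod (\<Sum>i\<in>F. \<Sum>j\<in>G. y i * b i j * x j)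
      \<le> C * (L2_set (\<lambda>i. cmod (y i)) F * L2_set (\<lambda>j. cmod (x j)) G)"
    using form_boundD[OF assms(1), of F G y x] by (simp add: mult.assoc)
  also have "\<dots> \<le> D * (L2_set (\<lambda>i. cmod (y i)) F * L2_set (\<lambda>j. cmod (x j)) G)"
    using assms(2) by (intro mult_right_mono mult_nonneg_nonneg L2_set_nonneg)
  finally show "cmod (\<Sum>i\<in>F. \<Sum>j\<in>G. y i * b i j * x j)
      \<le> D * L2_set (\<lambda>i. cmod (y i)) F * L2_set (\<lambda>j. cmod (x j)) G"
    by (simp add: mult.assoc)
qed

lemma form_bound_transpose:
  assumes "form_bound I C b"
  shows "form_bound I C (\<lambda>i j. b j i)"
proof (rule form_boundI)
  fix F G and x y :: "_ \<Rightarrow> complex" assume *: "finite F" "finite G" "F \<subseteq> I" "G \<subseteq> I"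
  have "(\<Sum>i\<in>F. \<Sum>j\<in>G. y i * b j i * x j) = (\<Sum>j\<in>G. \<Sum>i\<in>F. x j * b j i * y i)"
    by (subst sum.swap) (simp add: mult_ac)
  then show "cmod (\<Sum>i\<in>F. \<Sum>j\<in>G. y i * b j i * x j)
      \<le> C * L2_set (\<lambda>i. cmod (y i)) F * L2_set (\<lambda>j. cmod (x j)) G"
    using form_boundD[OF assms *(2,1) *(4,3), of x y] by (simp add: mult_ac)
qed

lemma L2_set_reindex:
  assumes "inj_on f F"
  shows "L2_set g (f ` F) = L2_set (g \<circ> f) F"
  using assms by (simp add: L2_set_def sum.reindex)

text \<open>Scalar matrices are cut out of block matrices in this way: moving the entries of a vector along
  \<open>f\<close> or \<open>g\<close> and filling up with zeros preserves its norm.\<close>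

lemma form_bound_compress:
  assumes "form_bound I C b" "inj_on f J" "inj_on g J" "f ` J \<subseteq> I" "g ` J \<subseteq> I"
  shows "form_bound J C (\<lambda>i j. b (f i) (g j))"
proof (rule form_boundI)
  fix F G and x y :: "_ \<Rightarrow> complex" assume *: "finite F" "finite G" "F \<subseteq> J" "G \<subseteq> J"
  have inj: "inj_on f F" "inj_on g G"
    using assms(2,3) *(3,4) by (auto intro: inj_on_subset)
  let ?y = "y \<circ> inv_into F f" and ?x = "x \<circ> inv_into G g"
  have "cmod (\<Sum>i\<in>f ` F. \<Sum>j\<in>g ` G. ?y i * b i j * ?x j)
      \<le> C * L2_set (\<lambda>i. cmod (?y i)) (f ` F) * L2_set (\<lambda>j. cmod (?x j)) (g ` G)"
    using * assms(4,5) by (intro form_boundD[OF assms(1)]) (simp, simp, blast, blast)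
  moreover have "(\<Sum>i\<in>f ` F. \<Sum>j\<in>g ` G. ?y i * b i j * ?x j)
      = (\<Sum>i\<in>F. \<Sum>j\<in>G. y i * b (f i) (g j) * x j)"
    by (simp add: sum.reindex inj)
  moreover have "L2_set (\<lambda>i. cmod (?y i)) (f ` F) = L2_set (\<lambda>i. cmod (y i)) F"
    by (subst L2_set_reindex[OF inj(1)]) (auto intro!: L2_set_cong simp: inj)
  moreover have "L2_set (\<lambda>i. cmod (?x i)) (g ` G) = L2_set (\<lambda>i. cmod (x i)) G"
    by (subst L2_set_reindex[OF inj(2)]) (auto intro!: L2_set_cong simp: inj)
  ultimately show "cmod (\<Sum>i\<in>F. \<Sum>j\<in>G. y i * b (f i) (g j) * x j)
      \<le> C * L2_set (\<lambda>i. cmod (y i)) F * L2_set (\<lambda>j. cmod (x j)) G"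
    by simp
qed

lemma norm_sum_mult_le_L2:
  "cmod (\<Sum>i\<in>F. y i * x i) \<le> L2_set (\<lambda>i. cmod (y i)) F * L2_set (\<lambda>i. cmod (x i)) F"
proof -
  have "cmod (\<Sum>i\<in>F. y i * x i) \<le> (\<Sum>i\<in>F. \<bar>cmod (y i)\<bar> * \<bar>cmod (x i)\<bar>)"
    by (rule norm_sum[THEN order_trans]) (simp add: norm_mult)
  also have "\<dots> \<le> L2_set (\<lambda>i. cmod (y i)) F * L2_set (\<lambda>i. cmod (x i)) F"
    by (rule L2_set_mult_ineq)
  finally show ?thesis .
qed

text \<open>Every row and every column has at most one nonzero entry, so Cauchy-Schwarz suffices. With
  \<open>\<sigma>\<close> the identity this covers diagonal matrices, with \<open>\<sigma>\<close> the exchange of coordinates the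
  weighted flip.\<close>

lemma form_bound_weighted_injection:
  assumes "inj_on \<sigma> I" "\<And>l. l \<in> I \<Longrightarrow> cmod (w l) \<le> C" "0 \<le> C"
  shows "form_bound I C (\<lambda>k l. if k = \<sigma> l then w l else 0)"
proof (rule form_boundI)
  fix F G and x y :: "_ \<Rightarrow> complex" assume *: "finite F" "finite G" "F \<subseteq> I" "G \<subseteq> I"
  let ?H = "{l\<in>G. \<sigma> l \<in> F}"
  have fin: "finite ?H" using * by simp
  have "(\<Sum>k\<in>F. \<Sum>l\<in>G. y k * (if k = \<sigma> l then w l else 0) * x l)
      = (\<Sum>l\<in>G. \<Sum>k\<in>F. if k = \<sigma> l then y k * w l * x l else 0)"
    by (subst sum.swap) (auto intro!: sum.cong)
  also have "\<dots> = (\<Sum>l\<in>?H. y (\<sigma> l) * (w l * x l))"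
    using * by (simp add: sum.inter_filter mult.assoc cong: if_cong)
  finally have "cmod (\<Sum>k\<in>F. \<Sum>l\<in>G. y k * (if k = \<sigma> l then w l else 0) * x l)
      \<le> L2_set (\<lambda>l. cmod (y (\<sigma> l))) ?H * L2_set (\<lambda>l. cmod (w l * x l)) ?H"
    using norm_sum_mult_le_L2 by metis
  also have "\<dots> \<le> L2_set (\<lambda>k. cmod (y k)) F * (C * L2_set (\<lambda>l. cmod (x l)) G)"
  proof (intro mult_mono L2_set_nonneg)
    have "L2_set (\<lambda>l. cmod (y (\<sigma> l))) ?H = L2_set (\<lambda>k. cmod (y k)) (\<sigma> ` ?H)"
      using * by (subst L2_set_reindex) (auto intro!: inj_on_subset[OF assms(1)] simp: o_def)
    also have "\<dots> \<le> L2_set (\<lambda>k. cmod (y k)) F"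
      unfolding L2_set_def using * by (intro real_sqrt_le_mono sum_mono2) auto
    finally show "L2_set (\<lambda>l. cmod (y (\<sigma> l))) ?H \<le> L2_set (\<lambda>k. cmod (y k)) F" .
    have "L2_set (\<lambda>l. cmod (w l * x l)) ?H \<le> L2_set (\<lambda>l. C * cmod (x l)) ?H"
      using * assms(2) by (intro L2_set_mono) (auto simp: norm_mult intro!: mult_right_mono)
    also have "\<dots> \<le> L2_set (\<lambda>l. C * cmod (x l)) G"
      unfolding L2_set_def using * by (intro real_sqrt_le_mono sum_mono2) auto
    also have "\<dots> = C * L2_set (\<lambda>l. cmod (x l)) G"
      using assms(3) by (simp add: L2_set_right_distrib)
    finally show "L2_set (\<lambda>l. cmod (w l * x l)) ?H \<le> C * L2_set (\<lambda>l. cmod (x l)) G" .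
  qed
  finally show "cmod (\<Sum>k\<in>F. \<Sum>l\<in>G. y k * (if k = \<sigma> l then w l else 0) * x l)
      \<le> C * L2_set (\<lambda>k. cmod (y k)) F * L2_set (\<lambda>l. cmod (x l)) G"
    by (simp add: mult_ac)
qed

lemma le_if_sq_le_mult:
  fixes L K :: real
  assumes "L\<^sup>2 \<le> K * L" "0 \<le> K"
  shows "L \<le> K"
  using assms by (metis mult_le_cancel_right not_less order_less_imp_le order_trans power2_eq_square)

lemma sum_norm_sq_eq_L2: "(\<Sum>i\<in>F. (cmod (z i))\<^sup>2) = (L2_set (\<lambda>i. cmod (z i)) F)\<^sup>2"
  by (simp add: L2_set_def sum_nonneg)

text \<open>Pair the finite part of \<open>b x\<close> with its own conjugate and cancel one factor of its norm.\<close>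

lemma form_bound_imp_L2_set_le:
  assumes "form_bound I C b" "0 \<le> C" "finite F" "F \<subseteq> I" "finite G" "G \<subseteq> I"
  shows "L2_set (\<lambda>i. cmod (\<Sum>j\<in>G. b i j * x j)) F \<le> C * L2_set (\<lambda>j. cmod (x j)) G"
proof (rule le_if_sq_le_mult)
  let ?z = "\<lambda>i. \<Sum>j\<in>G. b i j * x j"
  have "(\<Sum>i\<in>F. \<Sum>j\<in>G. cnj (?z i) * b i j * x j) = (\<Sum>i\<in>F. cnj (?z i) * ?z i)"
    by (simp only: sum_distrib_left mult.assoc)
  also have "\<dots> = of_real ((L2_set (\<lambda>i. cmod (?z i)) F)\<^sup>2)"
    unfolding sum_norm_sq_eq_L2[symmetric] of_real_sum
    by (intro sum.cong refl) (metis complex_norm_square mult.commute)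
  finally have "cmod (\<Sum>i\<in>F. \<Sum>j\<in>G. cnj (?z i) * b i j * x j) = (L2_set (\<lambda>i. cmod (?z i)) F)\<^sup>2"
    by (simp only: norm_of_real abs_power2)
  then show "(L2_set (\<lambda>i. cmod (?z i)) F)\<^sup>2
      \<le> C * L2_set (\<lambda>j. cmod (x j)) G * L2_set (\<lambda>i. cmod (?z i)) F"
    using form_boundD[OF assms(1,3,5,4,6), of "\<lambda>i. cnj (?z i)" x]
    by (simp add: mult_ac del: cnj_sum complex_cnj_mult)
  show "0 \<le> C * L2_set (\<lambda>j. cmod (x j)) G"
    using assms(2) by (simp add: L2_set_nonneg)
qed

lemma summable_on_if_finite_sums_le:
  fixes f :: "'i \<Rightarrow> real"
  assumes "\<And>i. i \<in> I \<Longrightarrow> 0 \<le> f i" "\<And>F. finite F \<Longrightarrow> F \<subseteq> I \<Longrightarrow> sum f F \<le> K"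
  shows "f summable_on I"
  using assms by (intro nonneg_bdd_above_summable_on) (auto intro!: bdd_aboveI[of _ K])

lemma ell2_norm_le:
  assumes "\<And>F. finite F \<Longrightarrow> F \<subseteq> I \<Longrightarrow> L2_set (\<lambda>i. cmod (z i)) F \<le> K" "0 \<le> K"
  shows "z \<in> ell2 I" "ell2_norm I z \<le> K"
proof -
  have le: "(\<Sum>i\<in>F. (cmod (z i))\<^sup>2) \<le> K\<^sup>2" if "finite F" "F \<subseteq> I" for F
    using assms(1)[OF that] by (simp add: sum_norm_sq_eq_L2 L2_set_nonneg power_mono)
  have s: "(\<lambda>i. (cmod (z i))\<^sup>2) summable_on I"
    using le by (intro summable_on_if_finite_sums_le[where K="K\<^sup>2"]) auto
  then show "z \<in> ell2 I" by (simp add: ell2_def)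
  have "(\<Sum>\<^sub>\<infinity>i\<in>I. (cmod (z i))\<^sup>2) \<le> K\<^sup>2"
    by (rule infsum_le_finite_sums[OF s]) (use le in auto)
  then show "ell2_norm I z \<le> K"
    unfolding ell2_norm_def using assms(2) by (simp add: real_le_lsqrt)
qed

lemma L2_set_le_ell2_norm:
  assumes "z \<in> ell2 I" "finite F" "F \<subseteq> I"
  shows "L2_set (\<lambda>i. cmod (z i)) F \<le> ell2_norm I z"
  unfolding L2_set_def ell2_norm_def
  using assms by (intro real_sqrt_le_mono finite_sum_le_infsum) (auto simp: ell2_def)

lemma ell2_norm_nonneg: "0 \<le> ell2_norm I z"
  by (simp add: ell2_norm_def infsum_nonneg)

text \<open>The rows of \<open>b\<close> are square-summable (the finite estimate for the transpose at a basis
  vector), so the sums defining \<open>b x\<close> converge absolutely; the norm estimate then passes to the limit over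
  the finite supports of \<open>x\<close>, for each finite set of rows separately.\<close>

lemma form_bound_imp_mat_app:
  assumes b: "form_bound I C b" and C: "0 \<le> C" and x: "x \<in> ell2 I"
  shows "i \<in> I \<Longrightarrow> (\<lambda>j. b i j * x j) summable_on I"
    and "mat_app I b x \<in> ell2 I"
    and "ell2_norm I (mat_app I b x) \<le> C * ell2_norm I x"
proof -
  have sm: "(\<lambda>j. b i j * x j) summable_on I" if i: "i \<in> I" for i
  proof -
    have "(\<lambda>j. norm (b i j * x j)) summable_on I"
    proof (rule abs_summable_product)
      have "(\<Sum>j\<in>G. (cmod (b i j))\<^sup>2) \<le> C\<^sup>2" if G: "finite G" "G \<subseteq> I" for G
      proof -
        have "L2_set (\<lambda>j. cmod (b i j)) G \<le> C"
          using form_bound_imp_L2_set_le[OF form_bound_transpose[OF b] C G, of "{i}" "\<lambda>_. 1"] i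
          by (simp add: L2_set_def)
        then show ?thesis
          by (simp add: sum_norm_sq_eq_L2 L2_set_nonneg power_mono)
      qed
      then show "(\<lambda>j. norm (b i j * b i j)) summable_on I"
        by (intro summable_on_if_finite_sums_le[where K="C\<^sup>2"])
          (auto simp: norm_mult power2_eq_square)
      show "(\<lambda>j. norm (x j * x j)) summable_on I"
        using x by (simp add: ell2_def norm_mult power2_eq_square)
    qed
    then show ?thesis by (rule abs_summable_summable)
  qed
  then show "i \<in> I \<Longrightarrow> (\<lambda>j. b i j * x j) summable_on I" by blast
  have le: "L2_set (\<lambda>i. cmod (mat_app I b x i)) F \<le> C * ell2_norm I x"
    if F: "finite F" "F \<subseteq> I" for F
  proof (rule tendsto_upperbound)
    show "((\<lambda>G. L2_set (\<lambda>i. cmod (\<Sum>j\<in>G. b i j * x j)) F)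
        \<longlongrightarrow> L2_set (\<lambda>i. cmod (mat_app I b x i)) F) (finite_subsets_at_top I)"
      unfolding L2_set_def mat_app_def
      using F sm by (intro tendsto_intros infsum_tendsto) auto
    have "L2_set (\<lambda>i. cmod (\<Sum>j\<in>G. b i j * x j)) F \<le> C * ell2_norm I x"
      if G: "finite G" "G \<subseteq> I" for G
      using form_bound_imp_L2_set_le[OF b C F G, of x] mult_left_mono[OF L2_set_le_ell2_norm[OF x G] C]
      by linarith
    then show "\<forall>\<^sub>F G in finite_subsets_at_top I.
        L2_set (\<lambda>i. cmod (\<Sum>j\<in>G. b i j * x j)) F \<le> C * ell2_norm I x"
      by (intro eventually_finite_subsets_at_top_weakI)
  qed simp
  show "mat_app I b x \<in> ell2 I" "ell2_norm I (mat_app I b x) \<le> C * ell2_norm I x"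
    using ell2_norm_le[OF le] C ell2_norm_nonneg[of I x] by auto
qed

lemma zero_in_ell2: "(\<lambda>_. 0) \<in> ell2 I"
  and ell2_norm_zero: "ell2_norm I (\<lambda>_. 0) = 0"
  by (auto simp: ell2_def ell2_norm_def)

lemma form_bound_imp_bounded_matrix:
  assumes "form_bound I C b" "0 \<le> C"
  shows "bounded_matrix I b" "op_norm I b \<le> C"
proof -
  note * = form_bound_imp_mat_app[OF assms]
  show "bounded_matrix I b"
    unfolding bounded_matrix_def using * by blast
  show "op_norm I b \<le> C"
    unfolding op_norm_def
  proof (rule cSup_least)
    show "{ell2_norm I (mat_app I b x) |x. x \<in> ell2 I \<and> ell2_norm I x \<le> 1} \<noteq> {}"
      using zero_in_ell2[of I] ell2_norm_zero[of I] by (metis (mono_tags, lifting) empty_iff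
          mem_Collect_eq zero_le_one)
    fix r assume "r \<in> {ell2_norm I (mat_app I b x) |x. x \<in> ell2 I \<and> ell2_norm I x \<le> 1}"
    then obtain x where x: "x \<in> ell2 I" "ell2_norm I x \<le> 1" "r = ell2_norm I (mat_app I b x)"
      by blast
    show "r \<le> C"
      using *(3)[OF x(1)] x(3) mult_left_mono[OF x(2) assms(2)] by simp
  qed
qed

text \<open>The constant in the definition of boundedness makes the supremum in the operator norm one of a
  set bounded above; homogeneity then extends its bound from the unit ball to all vectors.\<close>

lemma
  assumes b: "bounded_matrix I b"
  shows op_norm_nonneg: "0 \<le> op_norm I b"
    and ell2_norm_mat_app_le: "x \<in> ell2 I \<Longrightarrow> ell2_norm I (mat_app I b x) \<le> op_norm I b * ell2_norm I x"
proof -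
  obtain C where C: "\<And>x. x \<in> ell2 I \<Longrightarrow> ell2_norm I (mat_app I b x) \<le> C * ell2_norm I x"
    using b unfolding bounded_matrix_def by blast
  let ?S = "{ell2_norm I (mat_app I b x) |x. x \<in> ell2 I \<and> ell2_norm I x \<le> 1}"
  have bdd: "bdd_above ?S"
  proof (rule bdd_aboveI[of _ "\<bar>C\<bar>"])
    fix r assume "r \<in> ?S"
    then obtain x where x: "x \<in> ell2 I" "ell2_norm I x \<le> 1" "r = ell2_norm I (mat_app I b x)"
      by blast
    have "r \<le> C * ell2_norm I x" using C x by simp
    also have "\<dots> \<le> \<bar>C\<bar> * 1"
      using x ell2_norm_nonneg[of I x] by (intro mult_mono) auto
    finally show "r \<le> \<bar>C\<bar>" by simp
  qed
  have up: "ell2_norm I (mat_app I b x) \<le> op_norm I b" if "x \<in> ell2 I" "ell2_norm I x \<le> 1" for x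
    unfolding op_norm_def using that by (intro cSup_upper bdd) blast
  from up[OF zero_in_ell2] show "0 \<le> op_norm I b"
    using ell2_norm_nonneg[of I "mat_app I b (\<lambda>_. 0)"] by (simp add: ell2_norm_zero)
  show "ell2_norm I (mat_app I b x) \<le> op_norm I b * ell2_norm I x" if x: "x \<in> ell2 I"
  proof (cases "ell2_norm I x = 0")
    \<comment> \<open>Here normalizing is impossible, but any constant \<open>C\<close> already forces \<open>b x\<close> to have norm 0.\<close>
    case True
    then show ?thesis using C[OF x] by simp
  next
    case False
    let ?N = "ell2_norm I x" and ?x = "\<lambda>j. x j / of_real (ell2_norm I x)"
    have N: "0 < ?N" using False ell2_norm_nonneg[of I x] by simp
    have scale: "ell2_norm I (\<lambda>j. z j / of_real r) = ell2_norm I z / r" if "0 < r" for z r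
      using that by (simp add: ell2_norm_def norm_divide norm_mult norm_inverse power_divide
          power_mult_distrib divide_inverse infsum_cmult_left' real_sqrt_mult)
    have "?x \<in> ell2 I"
      using x by (simp add: ell2_def norm_mult power_mult_distrib divide_inverse summable_on_cmult_left)
    then have "ell2_norm I (mat_app I b ?x) \<le> op_norm I b"
      using N by (intro up) (simp_all add: scale[OF N])
    moreover have "mat_app I b ?x = (\<lambda>i. mat_app I b x i / of_real ?N)"
      by (simp add: mat_app_def divide_inverse infsum_cmult_left' flip: mult.assoc)
    ultimately show ?thesis
      using N by (simp add: scale[OF N] field_simps)
  qed
qed

lemma bounded_matrix_imp_form_bound:
  assumes b: "bounded_matrix I b"
  shows "form_bound I (op_norm I b) b"
proof (rule form_boundI)
  fix F G and x y :: "_ \<Rightarrow> complex" assume *: "finite F" "finite G" "F \<subseteq> I" "G \<subseteq> I"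
  let ?x = "\<lambda>j. if j \<in> G then x j else 0"
  let ?N = "L2_set (\<lambda>j. cmod (x j)) G"
  have sum_eq: "(\<Sum>\<^sub>\<infinity>j\<in>I. f j) = sum f G" if "\<And>j. j \<notin> G \<Longrightarrow> f j = 0" for f :: "'a \<Rightarrow> 'b::{t2_space,comm_monoid_add,topological_comm_monoid_add}"
    using * that by (subst infsum_cong_neutral[of G I f f]) auto
  have "L2_set (\<lambda>i. cmod (?x i)) H \<le> ?N" if "finite H" for H
  proof -
    have "(\<Sum>j\<in>H. (cmod (?x j))\<^sup>2) = (\<Sum>j\<in>H \<inter> G. (cmod (x j))\<^sup>2)"
      using that by (intro sum.mono_neutral_cong_right) auto
    also have "\<dots> \<le> (\<Sum>j\<in>G. (cmod (x j))\<^sup>2)"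
      using * by (intro sum_mono2) auto
    finally show ?thesis unfolding L2_set_def by (rule real_sqrt_le_mono)
  qed
  then have x: "?x \<in> ell2 I" "ell2_norm I ?x \<le> ?N"
    using ell2_norm_le[of I ?x ?N] L2_set_nonneg by auto
  have app: "mat_app I b ?x i = (\<Sum>j\<in>G. b i j * x j)" for i
    unfolding mat_app_def by (subst sum_eq) auto
  have in_ell2: "mat_app I b ?x \<in> ell2 I"
    using b x(1) unfolding bounded_matrix_def by blast
  have "(\<Sum>i\<in>F. \<Sum>j\<in>G. y i * b i j * x j) = (\<Sum>i\<in>F. y i * mat_app I b ?x i)"
    unfolding app by (simp add: sum_distrib_left mult.assoc)
  then have "cmod (\<Sum>i\<in>F. \<Sum>j\<in>G. y i * b i j * x j)
      \<le> L2_set (\<lambda>i. cmod (y i)) F * L2_set (\<lambda>i. cmod (mat_app I b ?x i)) F"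
    using norm_sum_mult_le_L2[of y "mat_app I b ?x" F] by simp
  also have "\<dots> \<le> L2_set (\<lambda>i. cmod (y i)) F * (op_norm I b * ?N)"
  proof (rule mult_left_mono[OF _ L2_set_nonneg])
    have "L2_set (\<lambda>i. cmod (mat_app I b ?x i)) F \<le> ell2_norm I (mat_app I b ?x)"
      using in_ell2 * by (intro L2_set_le_ell2_norm)
    also have "\<dots> \<le> op_norm I b * ell2_norm I ?x"
      by (rule ell2_norm_mat_app_le[OF b x(1)])
    also have "\<dots> \<le> op_norm I b * ?N"
      using x(2) op_norm_nonneg[OF b] by (intro mult_left_mono)
    finally show "L2_set (\<lambda>i. cmod (mat_app I b ?x i)) F \<le> op_norm I b * ?N" .
  qed
  finally show "cmod (\<Sum>i\<in>F. \<Sum>j\<in>G. y i * b i j * x j)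
      \<le> op_norm I b * L2_set (\<lambda>i. cmod (y i)) F * ?N"
    by (simp add: mult_ac)
qed

lemma op_norm_transpose_le:
  assumes "bounded_matrix I b"
  shows "bounded_matrix I (\<lambda>i j. b j i)" "op_norm I (\<lambda>i j. b j i) \<le> op_norm I b"
  using form_bound_imp_bounded_matrix[OF form_bound_transpose[OF bounded_matrix_imp_form_bound[OF assms]]]
    op_norm_nonneg[OF assms] by auto

lemma op_norm_transpose:
  assumes "bounded_matrix I b"
  shows "op_norm I (\<lambda>i j. b j i) = op_norm I b"
  using op_norm_transpose_le[OF assms] op_norm_transpose_le(2)[of I "\<lambda>i j. b j i"] by simp

section \<open>Block matrices\<close>

text \<open>A vector with finite support in \<open>N \<times> UNIV\<close> can be extended by zero to a rectangle \<open>N \<times> F\<close>, where the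
  sums over inner and outer indices separate. The bound is stated with nested norms since it is
  the pieces of length \<open>N\<close>, indexed by \<open>i\<close>, that are estimated later.\<close>

lemma form_bound_rectangles:
  fixes b :: "'p \<times> 'i \<Rightarrow> 'p \<times> 'i \<Rightarrow> complex"
  assumes N: "finite N"
    and rect: "\<And>F G x y. finite F \<Longrightarrow> finite G \<Longrightarrow>
        cmod (\<Sum>i\<in>F. \<Sum>j\<in>G. \<Sum>p\<in>N. \<Sum>q\<in>N. y p i * b (p, i) (q, j) * x q j)
          \<le> C * L2_set (\<lambda>i. L2_set (\<lambda>p. cmod (y p i)) N) F
              * L2_set (\<lambda>j. L2_set (\<lambda>q. cmod (x q j)) N) G"
  shows "form_bound (N \<times> UNIV) C b"
proof (rule form_boundI)
  fix F G :: "('p \<times> 'i) set" and x y :: "'p \<times> 'i \<Rightarrow> complex"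
  assume *: "finite F" "finite G" "F \<subseteq> N \<times> UNIV" "G \<subseteq> N \<times> UNIV"
  let ?F = "snd ` F" and ?G = "snd ` G"
  let ?y = "\<lambda>k. if k \<in> F then y k else 0" and ?x = "\<lambda>k. if k \<in> G then x k else 0"
  have ext: "(\<Sum>i\<in>snd ` H. \<Sum>p\<in>N. if (p, i) \<in> H then f (p, i) else 0) = sum f H"
    if "finite H" "H \<subseteq> N \<times> UNIV" for H and f :: "'p \<times> 'i \<Rightarrow> 'c::comm_monoid_add"
  proof -
    have "H \<subseteq> N \<times> snd ` H" using that by force
    have "(\<Sum>i\<in>snd ` H. \<Sum>p\<in>N. if (p, i) \<in> H then f (p, i) else 0)
        = (\<Sum>k\<in>N \<times> snd ` H. if k \<in> H then f k else 0)"
      by (subst sum.swap, subst sum.cartesian_product) (auto intro!: sum.cong)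
    also have "\<dots> = sum f H"
      using that N \<open>H \<subseteq> N \<times> snd ` H\<close> by (intro sum.mono_neutral_cong_right) auto
    finally show ?thesis .
  qed
  have L2: "L2_set (\<lambda>i. L2_set (\<lambda>p. cmod (if (p, i) \<in> H then z (p, i) else 0)) N) (snd ` H)
      = L2_set (\<lambda>k. cmod (z k)) H"
    if "finite H" "H \<subseteq> N \<times> UNIV" for H :: "('p \<times> 'i) set" and z
  proof -
    have "(cmod (if P then u else 0))\<^sup>2 = (if P then (cmod u)\<^sup>2 else 0)" for P u
      by simp
    then have "(\<Sum>i\<in>snd ` H. \<Sum>p\<in>N. (cmod (if (p, i) \<in> H then z (p, i) else 0))\<^sup>2)
        = (\<Sum>k\<in>H. (cmod (z k))\<^sup>2)"
      using ext[OF that, of "\<lambda>k. (cmod (z k))\<^sup>2"] by (simp only:)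
    then show ?thesis
      by (simp add: L2_set_def sum_nonneg)
  qed
  have "(\<Sum>i\<in>?F. \<Sum>j\<in>?G. \<Sum>p\<in>N. \<Sum>q\<in>N. ?y (p, i) * b (p, i) (q, j) * ?x (q, j))
      = (\<Sum>i\<in>?F. \<Sum>p\<in>N. if (p, i) \<in> F then
           (\<Sum>j\<in>?G. \<Sum>q\<in>N. if (q, j) \<in> G then y (p, i) * b (p, i) (q, j) * x (q, j) else 0) else 0)"
    by (rule sum.cong[OF refl], subst sum.swap) (auto intro!: sum.cong)
  also have "\<dots> = (\<Sum>k\<in>F. \<Sum>l\<in>G. y k * b k l * x l)"
    by (subst ext[OF *(2,4)], subst ext[OF *(1,3)]) simp
  finally show "cmod (\<Sum>i\<in>F. \<Sum>j\<in>G. y i * b i j * x j)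
      \<le> C * L2_set (\<lambda>i. cmod (y i)) F * L2_set (\<lambda>j. cmod (x j)) G"
    using rect[of ?F ?G "\<lambda>p i. ?y (p, i)" "\<lambda>q j. ?x (q, j)"] * by (simp only: L2 finite_imageI)
qed

lemma norm_double_sum:
  fixes f :: "'s \<Rightarrow> 't \<Rightarrow> 'v::real_normed_vector"
  shows "norm (\<Sum>p\<in>M. \<Sum>q\<in>N. f p q) \<le> (\<Sum>p\<in>M. \<Sum>q\<in>N. norm (f p q))"
  by (rule order_trans[OF norm_sum]) (intro sum_mono norm_sum)

lemma sum_swap_pairs:
  "(\<Sum>i\<in>F. \<Sum>j\<in>G. \<Sum>p\<in>M. \<Sum>q\<in>N. f i j p q) = (\<Sum>p\<in>M. \<Sum>q\<in>N. \<Sum>i\<in>F. \<Sum>j\<in>G. f i j p q)"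
proof -
  have *: "(\<Sum>j\<in>G. \<Sum>p\<in>M. \<Sum>q\<in>N. g j p q) = (\<Sum>p\<in>M. \<Sum>q\<in>N. \<Sum>j\<in>G. g j p q)"
    for G :: "'z set" and g
    by (subst sum.swap) (intro sum.cong refl sum.swap)
  show ?thesis
    by (rule trans[OF sum.cong[OF refl *] *])
qed

text \<open>The constant is crude; it serves only to show that block matrices of bounded
  matrices are bounded, so that their operator norms are meaningful.\<close>

lemma form_bound_block:
  fixes b :: "'p \<times> 'i \<Rightarrow> 'p \<times> 'i \<Rightarrow> complex"
  assumes N: "finite N"
    and K: "\<And>p q. p \<in> N \<Longrightarrow> q \<in> N \<Longrightarrow> form_bound UNIV (K p q) (\<lambda>i j. b (p, i) (q, j))"
    and K0: "\<And>p q. p \<in> N \<Longrightarrow> q \<in> N \<Longrightarrow> 0 \<le> K p q"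
  shows "form_bound (N \<times> UNIV) (\<Sum>p\<in>N. \<Sum>q\<in>N. K p q) b"
proof (rule form_bound_rectangles[OF N])
  fix F G :: "'i set" and x y :: "'p \<Rightarrow> 'i \<Rightarrow> complex"
  assume FG: "finite F" "finite G"
  let ?Y = "L2_set (\<lambda>i. L2_set (\<lambda>p. cmod (y p i)) N) F"
  let ?X = "L2_set (\<lambda>j. L2_set (\<lambda>q. cmod (x q j)) N) G"
  have le: "L2_set (\<lambda>i. cmod (z p i)) H \<le> L2_set (\<lambda>i. L2_set (\<lambda>p. cmod (z p i)) N) H"
    if "p \<in> N" for p H and z :: "'p \<Rightarrow> 'i \<Rightarrow> complex"
    using member_le_L2_set[OF N that, of "\<lambda>p. cmod (z p _)"] by (intro L2_set_mono) auto
  have "cmod (\<Sum>i\<in>F. \<Sum>j\<in>G. \<Sum>p\<in>N. \<Sum>q\<in>N. y p i * b (p, i) (q, j) * x q j)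
      \<le> (\<Sum>p\<in>N. \<Sum>q\<in>N. cmod (\<Sum>i\<in>F. \<Sum>j\<in>G. y p i * b (p, i) (q, j) * x q j))"
    by (subst sum_swap_pairs) (rule norm_double_sum)
  also have "\<dots> \<le> (\<Sum>p\<in>N. \<Sum>q\<in>N. K p q * ?Y * ?X)"
  proof (intro sum_mono)
    fix p q assume pq: "p \<in> N" "q \<in> N"
    have "cmod (\<Sum>i\<in>F. \<Sum>j\<in>G. y p i * b (p, i) (q, j) * x q j)
        \<le> K p q * L2_set (\<lambda>i. cmod (y p i)) F * L2_set (\<lambda>j. cmod (x q j)) G"
      by (rule form_boundD[OF K[OF pq] FG]) auto
    also have "\<dots> \<le> K p q * ?Y * ?X"
      using le pq K0[OF pq] by (intro mult_mono mult_nonneg_nonneg order_refl) auto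
    finally show "cmod (\<Sum>i\<in>F. \<Sum>j\<in>G. y p i * b (p, i) (q, j) * x q j)
        \<le> K p q * ?Y * ?X" .
  qed
  also have "\<dots> = (\<Sum>p\<in>N. \<Sum>q\<in>N. K p q) * ?Y * ?X"
    by (simp add: sum_distrib_right)
  finally show "cmod (\<Sum>i\<in>F. \<Sum>j\<in>G. \<Sum>p\<in>N. \<Sum>q\<in>N. y p i * b (p, i) (q, j) * x q j)
      \<le> (\<Sum>p\<in>N. \<Sum>q\<in>N. K p q) * ?Y * ?X" .
qed

lemma bounded_block_matrix:
  assumes "\<And>p q. p < n \<Longrightarrow> q < n \<Longrightarrow> bounded_matrix UNIV (\<iota> (a p q))"
  shows "bounded_matrix ({..<n} \<times> UNIV) (block_matrix \<iota> a)"
proof (rule form_bound_imp_bounded_matrix(1)[OF form_bound_block])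
  show "form_bound UNIV (op_norm UNIV (\<iota> (a p q))) (\<lambda>i j. block_matrix \<iota> a (p, i) (q, j))"
    if "p \<in> {..<n}" "q \<in> {..<n}" for p q
    using bounded_matrix_imp_form_bound[OF assms] that by (simp add: block_matrix_def)
  show nonneg: "0 \<le> op_norm UNIV (\<iota> (a p q))" if "p \<in> {..<n}" "q \<in> {..<n}" for p q
    using op_norm_nonneg[OF assms] that by simp
  show "0 \<le> (\<Sum>p<n. \<Sum>q<n. op_norm UNIV (\<iota> (a p q)))"
    by (intro sum_nonneg nonneg)
qed simp

lemma form_bound_block_matrix_if_embedded_mnorm_le:
  assumes "\<And>p q. p < n \<Longrightarrow> q < n \<Longrightarrow> bounded_matrix UNIV (\<iota> (a p q))"
    and "embedded_mnorm \<iota> n a \<le> C"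
  shows "form_bound ({..<n} \<times> UNIV) C (block_matrix \<iota> a)"
  using assms(2) bounded_matrix_imp_form_bound[OF bounded_block_matrix[of n \<iota> a, OF assms(1)]]
  unfolding embedded_mnorm_def by (rule form_bound_mono[rotated])

section \<open>Schur multipliers with bounded modulus\<close>

text \<open>For fixed \<open>i, j\<close> the sum over \<open>p, q\<close> is at most \<open>K |\<phi>\<^sub>i\<^sub>j|\<close> times the norms of the \<open>i\<close>-th piece
  of \<open>y\<close> and the \<open>j\<close>-th piece of \<open>x\<close>; what remains is the form of \<open>[|\<phi>\<^sub>i\<^sub>j|]\<close> at two vectors with
  nonnegative entries, whose norms are those of \<open>y\<close> and \<open>x\<close>.\<close>

lemma form_bound_schur_entrywise:
  fixes \<phi> :: "'i \<Rightarrow> 'i \<Rightarrow> complex" and s :: "'p \<Rightarrow> 'p \<Rightarrow> 'i \<Rightarrow> 'i \<Rightarrow> complex"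
  assumes \<phi>: "form_bound UNIV C (\<lambda>i j. of_real (cmod (\<phi> i j)))"
    and N: "finite N"
    and s: "\<And>i j. form_bound N K (\<lambda>p q. s p q i j)" "0 \<le> K"
  shows "form_bound (N \<times> UNIV) (K * C) (\<lambda>(p, i) (q, j). \<phi> i j * s p q i j)"
proof (rule form_bound_rectangles[OF N], unfold split_conv)
  fix F G :: "'i set" and x y :: "'p \<Rightarrow> 'i \<Rightarrow> complex"
  assume FG: "finite F" "finite G"
  let ?u = "\<lambda>i. L2_set (\<lambda>p. cmod (y p i)) N" and ?v = "\<lambda>j. L2_set (\<lambda>q. cmod (x q j)) N"
  have "cmod (\<Sum>i\<in>F. \<Sum>j\<in>G. \<Sum>p\<in>N. \<Sum>q\<in>N. y p i * (\<phi> i j * s p q i j) * x q j)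
      \<le> (\<Sum>i\<in>F. \<Sum>j\<in>G. K * (?u i * cmod (\<phi> i j) * ?v j))"
  proof (rule order_trans[OF norm_double_sum], intro sum_mono)
    fix i j
    have "(\<Sum>p\<in>N. \<Sum>q\<in>N. y p i * (\<phi> i j * s p q i j) * x q j)
        = \<phi> i j * (\<Sum>p\<in>N. \<Sum>q\<in>N. y p i * s p q i j * x q j)"
      by (simp add: sum_distrib_left mult_ac)
    then show "cmod (\<Sum>p\<in>N. \<Sum>q\<in>N. y p i * (\<phi> i j * s p q i j) * x q j)
        \<le> K * (?u i * cmod (\<phi> i j) * ?v j)"
      using mult_left_mono[OF form_boundD[OF s(1) N N order_refl order_refl,
            of "\<lambda>p. y p i" i j "\<lambda>q. x q j"], of "cmod (\<phi> i j)"]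
      by (simp add: norm_mult mult_ac)
  qed
  also have "\<dots> = K * cmod (of_real (\<Sum>i\<in>F. \<Sum>j\<in>G. ?u i * cmod (\<phi> i j) * ?v j))"
    by (simp only: norm_of_real) (simp add: sum_nonneg sum_distrib_left)
  also have "\<dots> = K * cmod (\<Sum>i\<in>F. \<Sum>j\<in>G. of_real (?u i) * of_real (cmod (\<phi> i j)) * of_real (?v j))"
    by (simp only: of_real_sum of_real_mult)
  also have "\<dots> \<le> K * (C * L2_set (\<lambda>i. cmod (of_real (?u i))) F
                       * L2_set (\<lambda>j. cmod (of_real (?v j))) G)"
    by (intro mult_left_mono[OF form_boundD[OF \<phi> FG] s(2)]) auto
  finally show "cmod (\<Sum>i\<in>F. \<Sum>j\<in>G. \<Sum>p\<in>N. \<Sum>q\<in>N. y p i * (\<phi> i j * s p q i j) * x q j)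
      \<le> K * C * L2_set ?u F * L2_set ?v G"
    by (simp add: mult.assoc)
qed

text \<open>The transposition of the outer indices is harmless because, at each inner position, it acts on a
  scalar matrix.\<close>

lemma mnorm_opposite_schur_le:
  assumes \<phi>: "form_bound UNIV C (abs_matrix \<phi>)" "0 \<le> C"
    and a: "\<And>p q. p < n \<Longrightarrow> q < n \<Longrightarrow> bounded_matrix UNIV (a p q)"
    and le: "embedded_mnorm (\<lambda>x. x) n a \<le> 1"
  shows "embedded_mnorm (\<lambda>x. x) n (\<lambda>p q. schur \<phi> (a q p)) \<le> C"
proof -
  have "form_bound {..<n} 1 (\<lambda>p q. block_matrix (\<lambda>x. x) a (p, i) (q, j))" for i j
    by (rule form_bound_compress[OF form_bound_block_matrix_if_embedded_mnorm_le[OF a le]])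
      (auto intro: inj_onI)
  then have "form_bound {..<n} 1 (\<lambda>p q. a q p i j)" for i j
    by (intro form_bound_transpose[of _ _ "\<lambda>p q. a p q i j"]) (simp add: block_matrix_def)
  then have "form_bound ({..<n} \<times> UNIV) (1 * C) (\<lambda>(p, i) (q, j). \<phi> i j * a q p i j)"
    using \<phi>(1) by (intro form_bound_schur_entrywise) (auto simp: abs_matrix_def)
  then show ?thesis
    unfolding mult_1_left embedded_mnorm_def block_matrix_def schur_def
    by (rule form_bound_imp_bounded_matrix(2)[OF _ \<phi>(2)])
qed

lemma bounded_matrix_diag:
  assumes "bounded (range f)"
  shows "bounded_matrix UNIV (diag f)"
proof -
  obtain K where K: "\<And>k. cmod (f k) \<le> K"
    using assms by (auto simp: bounded_iff)
  then have K0: "0 \<le> K" using norm_ge_zero order_trans by blast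
  have "diag f = (\<lambda>k l. if k = id l then f l else 0)"
    by (auto simp: diag_def fun_eq_iff)
  then show ?thesis
    using form_bound_imp_bounded_matrix(1)[OF form_bound_weighted_injection[of id UNIV f K]] K K0
    by simp
qed

text \<open>A matrix of functions is represented by diagonal operators, and its compression to the basis
  vector at \<open>(i, j)\<close> is the scalar matrix of the values at \<open>(i, j)\<close>.\<close>

lemma mnorm_linf_schur_le:
  assumes \<phi>: "form_bound UNIV C (abs_matrix \<phi>)" "0 \<le> C"
    and f: "\<And>p q. p < n \<Longrightarrow> q < n \<Longrightarrow> bounded (range (f p q))"
    and le: "embedded_mnorm diag n f \<le> 1"
  shows "embedded_mnorm (\<lambda>x. x) n (\<lambda>p q. linf_schur \<phi> (f p q)) \<le> C"
proof -
  have "form_bound {..<n} 1 (\<lambda>p q. block_matrix diag f (p, (i, j)) (q, (i, j)))" for i j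
    by (rule form_bound_compress[OF form_bound_block_matrix_if_embedded_mnorm_le[of n diag f,
            OF bounded_matrix_diag[OF f] le]])
      (auto intro: inj_onI)
  then have "form_bound {..<n} 1 (\<lambda>p q. f p q (i, j))" for i j
    by (simp add: block_matrix_def diag_def)
  then have "form_bound ({..<n} \<times> UNIV) (1 * C) (\<lambda>(p, i) (q, j). \<phi> i j * f p q (i, j))"
    using \<phi>(1) by (intro form_bound_schur_entrywise) (auto simp: abs_matrix_def)
  then show ?thesis
    unfolding mult_1_left embedded_mnorm_def block_matrix_def linf_schur_def
    by (rule form_bound_imp_bounded_matrix(2)[OF _ \<phi>(2)])
qed

section \<open>The flip as a test matrix\<close>

text \<open>The matrices \<open>c\<^sub>p\<^sub>q e\<^sub>q\<^sub>p\<close>, where \<open>e\<^sub>q\<^sub>p\<close> is the matrix unit with row \<open>q\<close> and column \<open>p\<close>: with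
  constant weight 1, the block matrix over them exchanges the two tensor factors.\<close>

definition weighted_flip :: "(nat \<Rightarrow> nat \<Rightarrow> complex) \<Rightarrow> nat \<Rightarrow> nat \<Rightarrow> nat \<Rightarrow> nat \<Rightarrow> complex" where
  "weighted_flip c p q = (\<lambda>i j. if i = q \<and> j = p then c p q else 0)"

lemma form_bound_weighted_flip:
  assumes "\<And>p q. cmod (c p q) \<le> 1"
  shows "form_bound UNIV 1 (block_matrix (\<lambda>x. x) (weighted_flip c))"
proof -
  have "block_matrix (\<lambda>x. x) (weighted_flip c)
      = (\<lambda>k l. if k = prod.swap l then c (snd l) (fst l) else 0)"
    by (auto simp: block_matrix_def weighted_flip_def fun_eq_iff)
  then show ?thesis
    using assms form_bound_weighted_injection[of prod.swap UNIV "\<lambda>l. c (snd l) (fst l)" 1]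
    by simp
qed

lemma form_bound_subset: "form_bound I C b \<Longrightarrow> J \<subseteq> I \<Longrightarrow> form_bound J C b"
  unfolding form_bound_def by blast

text \<open>The image of the weighted flip, compressed to the diagonal positions \<open>(p, p)\<close> and \<open>(q, q)\<close>, has
  entries \<open>\<phi>\<^sub>p\<^sub>q c\<^sub>q\<^sub>p\<close>.\<close>

lemma form_bound_abs_matrix_if_mnorm_opposite_schur_le:
  assumes C: "0 \<le> C"
    and \<phi>: "\<And>x. bounded_matrix UNIV x \<Longrightarrow> bounded_matrix UNIV (schur \<phi> x)"
    and le: "\<And>n a. 1 \<le> n \<Longrightarrow> (\<And>p q. bounded_matrix UNIV (a p q)) \<Longrightarrow>
        embedded_mnorm (\<lambda>x. x) n a \<le> 1 \<Longrightarrow>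
        embedded_mnorm (\<lambda>x. x) n (\<lambda>p q. schur \<phi> (a q p)) \<le> C"
  shows "form_bound UNIV C (abs_matrix \<phi>)"
proof -
  \<comment> \<open>The indices are exchanged because the entry of the image at \<open>(p, q)\<close> carries the weight \<open>c q p\<close>.\<close>
  define c where "c = (\<lambda>p q. cnj (sgn (\<phi> q p)))"
  let ?a = "weighted_flip c"
  have flip: "form_bound UNIV 1 (block_matrix (\<lambda>x. x) ?a)"
    by (rule form_bound_weighted_flip) (simp add: c_def norm_sgn)
  have "form_bound UNIV 1 (\<lambda>i j. block_matrix (\<lambda>x. x) ?a (p, i) (q, j))" for p q
    by (rule form_bound_compress[OF flip]) (auto intro: inj_onI)
  then have bdd: "bounded_matrix UNIV (?a p q)" for p q
    by (intro form_bound_imp_bounded_matrix(1)[of _ 1]) (simp_all add: block_matrix_def)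
  have "form_bound {..<n} C (abs_matrix \<phi>)" if "1 \<le> n" for n
  proof -
    have "embedded_mnorm (\<lambda>x. x) n ?a \<le> 1"
      unfolding embedded_mnorm_def
      by (intro form_bound_imp_bounded_matrix(2) form_bound_subset[OF flip]) auto
    then have "form_bound ({..<n} \<times> UNIV) C (block_matrix (\<lambda>x. x) (\<lambda>p q. schur \<phi> (?a q p)))"
      using bdd \<phi> that
      by (intro form_bound_block_matrix_if_embedded_mnorm_le[of n "\<lambda>x. x"] le) auto
    then have "form_bound {..<n} C
        (\<lambda>p q. block_matrix (\<lambda>x. x) (\<lambda>p q. schur \<phi> (?a q p)) (p, p) (q, q))"
      by (rule form_bound_compress) (auto intro: inj_onI)
    moreover have "z * cnj (sgn z) = of_real (cmod z)" for z
      by (cases "z = 0") (simp_all add: sgn_eq complex_norm_square[symmetric] power2_eq_square)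
    ultimately show ?thesis
      by (simp add: block_matrix_def schur_def weighted_flip_def c_def abs_matrix_def)
  qed
  moreover have "\<exists>n\<ge>1. F \<subseteq> {..<n} \<and> G \<subseteq> {..<n}" if "finite F" "finite G" for F G :: "nat set"
  proof -
    have "\<forall>k\<in>F \<union> G. k < Suc (Max (insert 0 (F \<union> G)))"
      using that by (auto simp: less_Suc_eq_le)
    then show ?thesis by (intro exI[of _ "Suc (Max (insert 0 (F \<union> G)))"]) auto
  qed
  ultimately show ?thesis
    unfolding form_bound_def by meson
qed

section \<open>Completely bounded norms\<close>

lemma cb_norm_le_iff:
  assumes "0 \<le> C"
  shows "cb_norm E F u \<le> ennreal C \<longleftrightarrow>
    (\<forall>n\<ge>1. \<forall>a. (\<forall>i<n. \<forall>j<n. a i j \<in> carr E) \<longrightarrow> mnorm E n a \<le> 1 \<longrightarrow>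
       mnorm F n (\<lambda>i j. u (a i j)) \<le> C)"
  using assms by (auto simp: cb_norm_def amp_norm_def SUP_le_iff)

lemma cob_norm_schur_le_iff:
  assumes C: "0 \<le> C"
    and \<phi>: "\<And>x. bounded_matrix UNIV x \<Longrightarrow> bounded_matrix UNIV (schur \<phi> x)"
  shows "cob_norm B_ell2 B_ell2 (schur \<phi>) \<le> ennreal C \<longleftrightarrow> form_bound UNIV C (abs_matrix \<phi>)"
proof
  assume "cob_norm B_ell2 B_ell2 (schur \<phi>) \<le> ennreal C"
  then have "embedded_mnorm (\<lambda>x. x) n (\<lambda>p q. schur \<phi> (a q p)) \<le> C"
    if "1 \<le> n" "\<And>p q. bounded_matrix UNIV (a p q)" "embedded_mnorm (\<lambda>x. x) n a \<le> 1" for n a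
    using that by (auto simp: cob_norm_def cb_norm_le_iff[OF C] B_ell2_def opposite_def)
  then show "form_bound UNIV C (abs_matrix \<phi>)"
    using form_bound_abs_matrix_if_mnorm_opposite_schur_le[OF C \<phi>] by blast
next
  assume "form_bound UNIV C (abs_matrix \<phi>)"
  then show "cob_norm B_ell2 B_ell2 (schur \<phi>) \<le> ennreal C"
    using C by (auto simp: cob_norm_def cb_norm_le_iff B_ell2_def opposite_def
        intro!: mnorm_opposite_schur_le)
qed

text \<open>The two images of a matrix \<open>[a\<^sub>p\<^sub>q]\<close>, with outer indices transposed and with inner indices
  transposed, are full transposes of each other, so they have the same norm.\<close>

lemma cob_norm_eq_cb_norm_transp:
  assumes u: "\<And>x. bounded_matrix UNIV x \<Longrightarrow> bounded_matrix UNIV (u x)"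
  shows "cob_norm B_ell2 B_ell2 u = cb_norm B_ell2 B_ell2 (mat_transp \<circ> u)"
proof -
  have "embedded_mnorm (\<lambda>x. x) n (\<lambda>p q. u (a q p))
      = embedded_mnorm (\<lambda>x. x) n (\<lambda>p q. mat_transp (u (a p q)))"
    if "\<forall>p<n. \<forall>q<n. bounded_matrix UNIV (a p q)" for n a
  proof -
    have "block_matrix (\<lambda>x. x) (\<lambda>p q. mat_transp (u (a p q)))
        = (\<lambda>k l. block_matrix (\<lambda>x. x) (\<lambda>p q. u (a q p)) l k)"
      by (auto simp: block_matrix_def mat_transp_def fun_eq_iff)
    then show ?thesis
      unfolding embedded_mnorm_def
      using that u by (simp add: op_norm_transpose bounded_block_matrix)
  qed
  then show ?thesis
    unfolding cob_norm_def cb_norm_def amp_norm_def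
    by (intro SUP_cong) (auto simp: B_ell2_def opposite_def)
qed

lemma bounded_range_incl:
  assumes "bounded_matrix UNIV x"
  shows "bounded (range (incl x))"
proof -
  have "cmod (x i j) \<le> op_norm UNIV x" for i j
    using form_boundD[OF bounded_matrix_imp_form_bound[OF assms], of "{i}" "{j}" "\<lambda>_. 1" "\<lambda>_. 1"]
    by simp
  then show ?thesis by (auto simp: bounded_iff incl_def)
qed

text \<open>This is the entrywise estimate with \<open>1 \<times> 1\<close> blocks, the scalar at \<open>(i, j)\<close> being \<open>f (i, j)\<close>.\<close>

lemma bounded_matrix_linf_schur:
  assumes \<phi>: "form_bound UNIV C (abs_matrix \<phi>)" "0 \<le> C" and f: "bounded (range f)"
  shows "bounded_matrix UNIV (linf_schur \<phi> f)"
proof -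
  obtain K where K: "\<And>k. cmod (f k) \<le> K"
    using f by (auto simp: bounded_iff)
  then have K0: "0 \<le> K" using norm_ge_zero order_trans by blast
  have "form_bound {()} K (\<lambda>_ _. f (i, j))" for i j
    using form_bound_weighted_injection[of id "{()}" "\<lambda>_. f (i, j)" K] K K0 by simp
  then have "form_bound ({()} \<times> UNIV) (K * C) (\<lambda>(p, i) (q, j). \<phi> i j * f (i, j))"
    using \<phi>(1) K0 by (intro form_bound_schur_entrywise) (auto simp: abs_matrix_def)
  from form_bound_compress[OF this, of "Pair ()" UNIV "Pair ()"]
  have "form_bound UNIV (K * C) (linf_schur \<phi> f)"
    by (simp add: linf_schur_def inj_on_def image_subset_iff)
  then show ?thesis
    using \<phi>(2) K0 by (auto intro: form_bound_imp_bounded_matrix(1))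
qed

theorem theorem4:
  fixes \<phi> :: "nat \<Rightarrow> nat \<Rightarrow> complex"
  assumes "\<forall>x\<in>carr B_ell2. schur \<phi> x \<in> carr B_ell2"
  shows "(completely_cobounded B_ell2 B_ell2 (schur \<phi>) \<longleftrightarrow> bounded_matrix UNIV (abs_matrix \<phi>)) \<and>
    (completely_cobounded B_ell2 B_ell2 (schur \<phi>) \<longrightarrow>
       completely_bounded B_ell2 B_ell2 (mat_transp \<circ> schur \<phi>) \<and>
       cob_norm B_ell2 B_ell2 (schur \<phi>) = cb_norm B_ell2 B_ell2 (mat_transp \<circ> schur \<phi>) \<and>
       cb_norm B_ell2 B_ell2 (mat_transp \<circ> schur \<phi>) = ennreal (op_norm UNIV (abs_matrix \<phi>))) \<and>
    (cob_norm B_ell2 B_ell2 (schur \<phi>) \<le> 1 \<longrightarrow>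
       linear_map B_ell2 linf incl \<and>
       completely_bounded linf B_ell2 (linf_schur \<phi>) \<and>
       cb_norm linf B_ell2 (linf_schur \<phi>) \<le> 1 \<and>
       (\<forall>x\<in>carr B_ell2. schur \<phi> x = linf_schur \<phi> (incl x)))"
proof -
  let ?A = "abs_matrix \<phi>" and ?cob = "cob_norm B_ell2 B_ell2 (schur \<phi>)"
  have \<phi>: "bounded_matrix UNIV (schur \<phi> x)" if "bounded_matrix UNIV x" for x
    using assms that by (simp add: B_ell2_def)
  note cob_le_iff = cob_norm_schur_le_iff[OF _ \<phi>]
  have linear: "linear_map B_ell2 (opposite B_ell2) (schur \<phi>)"
    "linear_map B_ell2 B_ell2 (mat_transp \<circ> schur \<phi>)"
    using \<phi> op_norm_transpose_le(1)[OF \<phi>]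
    by (auto simp: linear_map_def opposite_def B_ell2_def schur_def mat_transp_def algebra_simps)
  have cobounded_iff: "completely_cobounded B_ell2 B_ell2 (schur \<phi>) \<longleftrightarrow> ?cob < \<infinity>"
    using linear by (simp add: completely_cobounded_def completely_bounded_def cob_norm_def)
  have cob_eq: "?cob = ennreal (op_norm UNIV ?A)" if "bounded_matrix UNIV ?A"
  proof (rule antisym)
    show "?cob \<le> ennreal (op_norm UNIV ?A)"
      using that op_norm_nonneg bounded_matrix_imp_form_bound by (subst cob_le_iff) auto
    then have "?cob < \<infinity>" by (simp add: le_less_trans)
    then obtain C where C: "0 \<le> C" "?cob = ennreal C"
      by (cases ?cob) auto
    then have "form_bound UNIV C ?A" using cob_le_iff[OF C(1)] by simp
    then show "ennreal (op_norm UNIV ?A) \<le> ?cob"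
      using C form_bound_imp_bounded_matrix(2) by (simp add: ennreal_leI)
  qed
  have finite_iff: "?cob < \<infinity> \<longleftrightarrow> bounded_matrix UNIV ?A"
  proof
    assume "?cob < \<infinity>"
    then obtain C where C: "0 \<le> C" "?cob = ennreal C"
      by (cases ?cob) auto
    then show "bounded_matrix UNIV ?A"
      using cob_le_iff[OF C(1)] form_bound_imp_bounded_matrix(1)[of UNIV C] by simp
  qed (simp add: cob_eq)
  have factor: "linear_map B_ell2 linf incl \<and>
       completely_bounded linf B_ell2 (linf_schur \<phi>) \<and>
       cb_norm linf B_ell2 (linf_schur \<phi>) \<le> 1 \<and>
       (\<forall>x\<in>carr B_ell2. schur \<phi> x = linf_schur \<phi> (incl x))" if "?cob \<le> 1"
  proof (intro conjI)
    have A: "form_bound UNIV 1 ?A" using cob_le_iff[of 1] that by simp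
    show "linear_map B_ell2 linf incl"
      using bounded_range_incl by (auto simp: linear_map_def B_ell2_def linf_def incl_def)
    have "cb_norm linf B_ell2 (linf_schur \<phi>) \<le> ennreal 1"
      using mnorm_linf_schur_le[OF A] by (subst cb_norm_le_iff) (auto simp: linf_def B_ell2_def)
    then show le: "cb_norm linf B_ell2 (linf_schur \<phi>) \<le> 1" by simp
    show "completely_bounded linf B_ell2 (linf_schur \<phi>)"
      unfolding completely_bounded_def
    proof
      show "linear_map linf B_ell2 (linf_schur \<phi>)"
        using bounded_matrix_linf_schur[OF A]
        by (auto simp: linear_map_def B_ell2_def linf_def linf_schur_def algebra_simps)
      show "cb_norm linf B_ell2 (linf_schur \<phi>) < \<infinity>"
        using le by (simp add: le_less_trans)
    qed
    show "\<forall>x\<in>carr B_ell2. schur \<phi> x = linf_schur \<phi> (incl x)"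
      by (simp add: schur_def linf_schur_def incl_def)
  qed
  show ?thesis
    using cobounded_iff finite_iff cob_eq factor linear(2) cob_norm_eq_cb_norm_transp[OF \<phi>]
    by (simp add: completely_bounded_def)
qed

end
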